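(* Let $\mathbb F\in\{\mathbb R,\mathbb C\}$, let $N\ge 4$, and let $\mathcal A,\mathcal B\in\mathbb F^{I_1\times\dots\times I_N}$. If $$\operatorname{col}(\mathbf B_{(n^c;n)})\subseteq\operatorname{col}(\mathbf A_{(n^c;n)})\quad\text{for all } n\in\{1,\dots,N\},$$ then $$\operatorname{col}(\mathbf B_{(S^c;S)})\subseteq\operatorname{col}(\mathbf A_{(S^c;S)})\quad\text{for all nonempty proper subsets } S\text{ of }\{1,\dots,N\}.$$
   Context: $\operatorname{col}(\cdot)$ denotes the column space of a matrix. Mode-$S$ matrix representation: let $S=\{q_1<\dots<q_{N-k}\}$ be a nonempty proper subset of $\{1,\dots,N\}$ with complement $S^c=\{p_1<\dots<p_k\}$. For $\mathcal A\in\mathbb F^{I_1\times\dots\times I_N}$ with entries $a_{i_1\dots i_N}$, $\mathbf A_{(S^c;S)}$ is the $\left(\prod_{n\in S^c}I_n\right)\times\left(\prod_{n\in S}I_n\right)$ matrix whose entry in row $1+\sum_{u=1}^{k}(i_{p_u}-1)\prod_{s=1}^{u-1}I_{p_s}$ and column $1+\sum_{u=1}^{N-k}(i_{q_u}-1)\prod_{s=1}^{u-1}I_{q_s}$ equals $a_{i_1\dots i_N}$. For $S=\{n\}$ it is denoted $\mathbf A_{(n^c;n)}$. *)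

theory Defs
  imports Complex_Main "HOL-Library.FuncSet" "Jordan_Normal_Form.VS_Connect"
begin

text \<open>
  An order-\<open>N\<close> tensor of format \<open>I 1 \<times> \<dots> \<times> I N\<close> is a function on multi-indices \<open>i\<close>, where
  \<open>i n\<close> ranges over \<open>{1..I n}\<close> for \<open>n \<in> {1..N}\<close>.  Extensionality pins down the irrelevant
  values outside the index range, so that equality is entrywise equality.
\<close>

definition multi_indices :: "nat \<Rightarrow> (nat \<Rightarrow> nat) \<Rightarrow> (nat \<Rightarrow> nat) set" where
  "multi_indices N I = (\<Pi>\<^sub>E n\<in>{1..N}. {1..I n})"

definition tensors :: "nat \<Rightarrow> (nat \<Rightarrow> nat) \<Rightarrow> ((nat \<Rightarrow> nat) \<Rightarrow> 'a) set" where
  "tensors N I = multi_indices N I \<rightarrow>\<^sub>E UNIV"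

text \<open>
  For modes \<open>ps = [p\<^sub>1, \<dots>, p\<^sub>k]\<close> this is \<open>\<Sum>u=1..k. (i p\<^sub>u - 1) * (\<Prod>s=1..u-1. I p\<^sub>s)\<close>.  Tensor
  indices start at 1, whereas rows and columns of \<open>'a mat\<close> are numbered from 0; hence the usual
  leading \<open>1 +\<close> is absent.  The truncated subtraction is harmless because \<open>i p \<ge> 1\<close>.
\<close>

definition linear_index :: "(nat \<Rightarrow> nat) \<Rightarrow> nat list \<Rightarrow> (nat \<Rightarrow> nat) \<Rightarrow> nat" where
  "linear_index I ps i = (\<Sum>u<length ps. (i (ps ! u) - 1) * (\<Prod>s<u. I (ps ! s)))"

text \<open>
  The matrix \<open>A\<^bsub>(S\<^sup>c;S)\<^esub>\<close>: rows are indexed by the modes outside \<open>S\<close> and columns by the modes in \<open>S\<close>,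
  each taken in increasing order.  Existence and uniqueness of the multi-index selected by
  \<open>THE\<close> is \<open>ex1_multi_index\<close> below; \<open>mode_matrix_entry\<close> is the resulting entrywise description.
\<close>

definition mode_matrix ::
  "nat \<Rightarrow> (nat \<Rightarrow> nat) \<Rightarrow> nat set \<Rightarrow> ((nat \<Rightarrow> nat) \<Rightarrow> 'a) \<Rightarrow> 'a mat" where
  "mode_matrix N I S A =
     mat (\<Prod>n\<in>{1..N} - S. I n) (\<Prod>n\<in>S. I n)
       (\<lambda>(r, c). A (THE i. i \<in> multi_indices N I \<and>
          linear_index I (sorted_list_of_set ({1..N} - S)) i = r \<and>
          linear_index I (sorted_list_of_set S) i = c))"

abbreviation column_space :: "'a :: field mat \<Rightarrow> 'a vec set" where
  "column_space M \<equiv> vec_space.col_space (dim_row M) M"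

lemma linear_index_Cons:
  "linear_index I (p # ps) i = (i p - 1) + I p * linear_index I ps i"
  unfolding linear_index_def
  by (simp add: sum.lessThan_Suc_shift prod.lessThan_Suc_shift sum_distrib_left mult_ac
           del: sum.lessThan_Suc prod.lessThan_Suc)

lemma linear_index_less:
  assumes "distinct ps" "\<forall>p\<in>set ps. i p \<in> {1..I p}"
  shows "linear_index I ps i < (\<Prod>p\<in>set ps. I p)"
  using assms
proof (induction ps)
  case Nil
  then show ?case by (simp add: linear_index_def)
next
  case (Cons p ps)
  let ?L = "linear_index I ps i" and ?P = "\<Prod>p\<in>set ps. I p"
  have "?L + 1 \<le> ?P" and p: "i p \<in> {1..I p}"
    using Cons by auto
  then have "I p * (?L + 1) \<le> I p * ?P"
    by (intro mult_le_mono2)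
  with p have "(i p - 1) + I p * ?L < I p * ?P"
    by auto
  then show ?case
    using Cons.prems by (simp add: linear_index_Cons)
qed

lemma linear_index_inj:
  assumes "\<forall>p\<in>set ps. i p \<in> {1..I p}" "\<forall>p\<in>set ps. j p \<in> {1..I p}"
    and "linear_index I ps i = linear_index I ps j"
  shows "\<forall>p\<in>set ps. i p = j p"
  using assms
proof (induction ps)
  case Nil
  then show ?case by simp
next
  case (Cons p ps)
  have ip: "i p - 1 < I p" "1 \<le> i p" and jp: "j p - 1 < I p" "1 \<le> j p"
    using Cons.prems by auto
  have eq: "(i p - 1) + I p * linear_index I ps i = (j p - 1) + I p * linear_index I ps j"
    using Cons.prems(3) by (simp add: linear_index_Cons)
  have "x = y \<and> a = b" if "x + m * a = y + m * b" "x < m" "y < m" for x y a b m :: nat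
  proof -
    have "(x + m * a) mod m = x" "(y + m * b) mod m = y"
      and "(x + m * a) div m = a" "(y + m * b) div m = b"
      using that(2,3) by simp_all
    with that(1) show ?thesis
      by metis
  qed
  from this[OF eq ip(1) jp(1)]
  have p: "i p - 1 = j p - 1" and ps: "linear_index I ps i = linear_index I ps j"
    by auto
  from p ip(2) jp(2) have "i p = j p"
    by linarith
  moreover have "\<forall>q\<in>set ps. i q = j q"
    using Cons.prems(1,2) by (intro Cons.IH[OF _ _ ps]) auto
  ultimately show ?case
    by simp
qed

lemma linear_index_surj:
  assumes "distinct ps" "r < (\<Prod>p\<in>set ps. I p)"
  shows "\<exists>i. (\<forall>p\<in>set ps. i p \<in> {1..I p}) \<and> linear_index I ps i = r"
  using assms
proof (induction ps arbitrary: r)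
  case Nil
  then show ?case by (simp add: linear_index_def)
next
  case (Cons p ps)
  have r: "r < I p * (\<Prod>p\<in>set ps. I p)"
    using Cons.prems by simp
  then have pos: "I p > 0"
    by (cases "I p") auto
  have "r div I p < (\<Prod>p\<in>set ps. I p)"
    using r by (simp add: less_mult_imp_div_less mult.commute)
  then obtain i where i: "\<forall>p\<in>set ps. i p \<in> {1..I p}" "linear_index I ps i = r div I p"
    using Cons by auto
  let ?j = "i(p := r mod I p + 1)"
  have "linear_index I ps ?j = linear_index I ps i"
    unfolding linear_index_def using Cons.prems(1)
    by (intro sum.cong) auto
  then have "linear_index I (p # ps) ?j = r"
    unfolding linear_index_Cons i(2) by simp
  moreover have "\<forall>q\<in>set (p # ps). ?j q \<in> {1..I q}"
    using i(1) pos by (auto simp: Suc_le_eq)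
  ultimately show ?case
    by blast
qed

lemma linear_index_cong:
  "(\<And>p. p \<in> set ps \<Longrightarrow> i p = j p) \<Longrightarrow> linear_index I ps i = linear_index I ps j"
  unfolding linear_index_def by (intro sum.cong) auto

lemma ex1_multi_index:
  assumes S: "S \<subseteq> {1..N}"
    and "r < (\<Prod>n\<in>{1..N} - S. I n)" and "c < (\<Prod>n\<in>S. I n)"
  shows "\<exists>!i. i \<in> multi_indices N I \<and>
          linear_index I (sorted_list_of_set ({1..N} - S)) i = r \<and>
          linear_index I (sorted_list_of_set S) i = c"
proof -
  let ?ps = "sorted_list_of_set ({1..N} - S)" and ?qs = "sorted_list_of_set S"
  have fin: "finite S"
    using S finite_subset by blast
  have [simp]: "set ?ps = {1..N} - S" "set ?qs = S"
    using fin by auto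
  obtain i where i: "\<forall>p\<in>{1..N} - S. i p \<in> {1..I p}" "linear_index I ?ps i = r"
    using linear_index_surj[of ?ps r I] assms(2) by auto
  obtain j where j: "\<forall>p\<in>S. j p \<in> {1..I p}" "linear_index I ?qs j = c"
    using linear_index_surj[of ?qs c I] assms(3) fin by auto
  define k where "k = restrict (\<lambda>n. if n \<in> S then j n else i n) {1..N}"
  have "linear_index I ?ps k = linear_index I ?ps i"
    by (rule linear_index_cong) (auto simp: k_def)
  moreover have "linear_index I ?qs k = linear_index I ?qs j"
    using S by (intro linear_index_cong) (auto simp: k_def)
  moreover have "k \<in> multi_indices N I"
    using i(1) j(1) by (auto simp: k_def multi_indices_def)
  moreover have "x = y"
    if x: "x \<in> multi_indices N I" and y: "y \<in> multi_indices N I"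
      and p: "linear_index I ?ps x = linear_index I ?ps y"
      and q: "linear_index I ?qs x = linear_index I ?qs y" for x y
  proof -
    have b: "\<forall>n\<in>{1..N}. x n \<in> {1..I n}" "\<forall>n\<in>{1..N}. y n \<in> {1..I n}"
      using x y unfolding multi_indices_def by blast+
    have "\<forall>n\<in>set ?ps. x n = y n"
      using b by (intro linear_index_inj[OF _ _ p]) auto
    moreover have "\<forall>n\<in>set ?qs. x n = y n"
      using b S by (intro linear_index_inj[OF _ _ q]) auto
    ultimately have "x n = y n" if "n \<in> {1..N}" for n
      using that by (cases "n \<in> S") auto
    then show ?thesis
      using x y unfolding multi_indices_def by (blast intro: PiE_ext)
  qed
  ultimately show ?thesis
    using i(2) j(2) by (intro ex1I[of _ k]) auto
qed

lemma mode_matrix_entry: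
  assumes S: "S \<subseteq> {1..N}" and i: "i \<in> multi_indices N I"
  shows "linear_index I (sorted_list_of_set ({1..N} - S)) i < dim_row (mode_matrix N I S A)"
    and "linear_index I (sorted_list_of_set S) i < dim_col (mode_matrix N I S A)"
    and "mode_matrix N I S A $$
           (linear_index I (sorted_list_of_set ({1..N} - S)) i,
            linear_index I (sorted_list_of_set S) i) = A i"
proof -
  let ?ps = "sorted_list_of_set ({1..N} - S)" and ?qs = "sorted_list_of_set S"
  have fin: "finite S"
    using S finite_subset by blast
  have b: "\<forall>n\<in>{1..N}. i n \<in> {1..I n}"
    using i unfolding multi_indices_def by blast
  have r: "linear_index I ?ps i < (\<Prod>n\<in>{1..N} - S. I n)"
    using linear_index_less[of ?ps i I] b by auto
  have "\<forall>p\<in>set ?qs. i p \<in> {1..I p}"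
    using b S fin by auto
  then have c: "linear_index I ?qs i < (\<Prod>n\<in>S. I n)"
    using linear_index_less[of ?qs i I] fin by auto
  from r c show "linear_index I ?ps i < dim_row (mode_matrix N I S A)"
    and "linear_index I ?qs i < dim_col (mode_matrix N I S A)"
    by (simp_all add: mode_matrix_def)
  have "(THE k. k \<in> multi_indices N I \<and> linear_index I ?ps k = linear_index I ?ps i \<and>
          linear_index I ?qs k = linear_index I ?qs i) = i"
    using i by (intro the1_equality ex1_multi_index[OF S r c]) auto
  then show "mode_matrix N I S A $$ (linear_index I ?ps i, linear_index I ?qs i) = A i"
    using r c by (simp add: mode_matrix_def)
qed

end

theory Submission
  imports Defs
begin

text \<open>
  The inclusion for mode \<open>n\<close> says that every mode-\<open>n\<close> slice of \<open>B\<close> is a linear combination of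
  mode-\<open>n\<close> slices of \<open>A\<close>.  If \<open>n \<in> S\<close>, fixing the remaining indices in \<open>S\<close> in such a relation
  exhibits each column of the mode-\<open>S\<close> matrix of \<open>B\<close> as a combination of columns of that of \<open>A\<close>.
  Hence the inclusion for a single \<open>n \<in> S\<close> already gives the one for \<open>S\<close>.
\<close>

lemma column_space_iff:
  "v \<in> column_space M \<longleftrightarrow>
     v \<in> carrier_vec (dim_row M) \<and> (\<exists>x\<in>carrier_vec (dim_col M). M *\<^sub>v x = v)"
  for M :: "'a :: field mat"
proof -
  interpret vec_space "TYPE('a)" "dim_row M" .
  show ?thesis
    using col_space_eq[of M "dim_col M"] by auto
qed

text \<open>A column space is the span of the columns, and a span that contains those of
  \<open>B\<close> contains their span. This reduces the inclusion to single columns.\<close>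

lemma column_space_subsetI:
  fixes A B :: "'a :: field mat"
  assumes "dim_row A = dim_row B" and "\<And>j. j < dim_col B \<Longrightarrow> col B j \<in> column_space A"
  shows "column_space B \<subseteq> column_space A"
proof -
  interpret vec_space "TYPE('a)" "dim_row B" .
  have "set (cols B) \<subseteq> span (set (cols A))"
    using assms by (auto simp: cols_def col_space_def)
  moreover have "set (cols A) \<subseteq> carrier_vec (dim_row B)"
    using assms(1) cols_dim[of A] by simp
  ultimately show ?thesis
    unfolding col_space_def assms(1) by (intro span_subsetI)
qed

text \<open>Lets a combination of columns be indexed by any finite set \<open>K\<close>, here the
  values of one mode, instead of by column numbers.\<close>

lemma column_combination_in_column_space:
  fixes M :: "'a :: field mat"
  assumes "finite K" and f: "\<And>k. k \<in> K \<Longrightarrow> f k < dim_col M"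
    and "v \<in> carrier_vec (dim_row M)"
    and v: "\<And>r. r < dim_row M \<Longrightarrow> v $ r = (\<Sum>k\<in>K. M $$ (r, f k) * x k)"
  shows "v \<in> column_space M"
proof -
  \<comment> \<open>Coefficients that \<open>f\<close> sends to the same column are added
    up.\<close>
  define w where "w = vec (dim_col M) (\<lambda>c. \<Sum>k\<in>K. if c = f k then x k else 0)"
  have "M *\<^sub>v w = v"
  proof (rule eq_vecI)
    fix r assume "r < dim_vec v"
    then have r: "r < dim_row M"
      using assms(3) by simp
    have "(M *\<^sub>v w) $ r = (\<Sum>c<dim_col M. \<Sum>k\<in>K. if c = f k then M $$ (r, c) * x k else 0)"
      using r by (auto simp: w_def scalar_prod_def sum_distrib_left atLeast0LessThan
          intro!: sum.cong)
    also have "\<dots> = (\<Sum>k\<in>K. \<Sum>c<dim_col M. if c = f k then M $$ (r, c) * x k else 0)"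
      by (rule sum.swap)
    \<comment> \<open>Since \<open>f k < dim_col M\<close>, exactly the term with
      \<open>c = f k\<close> survives in the inner sum.\<close>
    also have "\<dots> = v $ r"
      using f by (simp add: v[OF r])
    finally show "(M *\<^sub>v w) $ r = v $ r" .
  qed (use assms(3) in simp)
  then show ?thesis
    using assms(3) unfolding column_space_iff by (auto simp: w_def)
qed

lemma multi_indices_fun_upd:
  assumes "i \<in> multi_indices N I" "n \<in> {1..N}" "k \<in> {1..I n}"
  shows "i(n := k) \<in> multi_indices N I"
  using assms unfolding multi_indices_def by (auto simp: PiE_iff extensional_def)

text \<open>The slice \<open>i n = m\<close> of \<open>B\<close> is column \<open>m - 1\<close> of
  its mode-\<open>n\<close> matrix, and \<open>x\<close> lists the coefficients of that column in
  terms of the columns for \<open>A\<close>. What matters later is that \<open>x\<close> is chosen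
  before \<open>i\<close>, so one \<open>x\<close> serves the whole slice.\<close>

lemma slice_combination:
  fixes A B :: "(nat \<Rightarrow> nat) \<Rightarrow> 'a :: field"
  assumes n: "n \<in> {1..N}" and m: "m \<in> {1..I n}"
    and sub: "column_space (mode_matrix N I {n} B) \<subseteq> column_space (mode_matrix N I {n} A)"
  obtains x where "\<And>i. i \<in> multi_indices N I \<Longrightarrow> i n = m \<Longrightarrow>
      B i = (\<Sum>k\<in>{1..I n}. A (i(n := k)) * x k)"
proof -
  let ?A = "mode_matrix N I {n} A" and ?B = "mode_matrix N I {n} B"
  let ?r = "linear_index I (sorted_list_of_set ({1..N} - {n}))"
  have dims: "dim_row ?A = dim_row ?B" "dim_col ?A = I n" "dim_col ?B = I n"
    by (simp_all add: mode_matrix_def)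
  have c: "linear_index I (sorted_list_of_set {n}) i = i n - 1" for i
    by (simp add: linear_index_def)
  have m': "m - 1 < dim_col ?B"
    using m by (auto simp: dims)
  \<comment> \<open>A column is the one-term combination of itself with coefficient 1.\<close>
  have "col ?B (m - 1) \<in> column_space ?B"
    by (rule column_combination_in_column_space[where K = "{()}" and f = "\<lambda>_. m - 1" and x = "\<lambda>_. 1"])
      (use m' in auto)
  with sub have "col ?B (m - 1) \<in> column_space ?A"
    by blast
  then obtain w where w: "w \<in> carrier_vec (I n)" "?A *\<^sub>v w = col ?B (m - 1)"
    unfolding column_space_iff dims(2) by blast
  show thesis
  proof
    fix i assume i: "i \<in> multi_indices N I" and im: "i n = m"
    have n': "{n} \<subseteq> {1..N}"
      using n by simp
    \<comment> \<open>The row number ignores mode \<open>n\<close>, so changing \<open>i n\<close>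
      moves only along the row.\<close>
    have A: "?A $$ (?r i, k - 1) = A (i(n := k))" if "k \<in> {1..I n}" for k
    proof -
      have "?r (i(n := k)) = ?r i"
        by (rule linear_index_cong) auto
      with mode_matrix_entry(3)[OF n' multi_indices_fun_upd[OF i n that], of A]
      show ?thesis
        unfolding c by simp
    qed
    have r: "?r i < dim_row ?B"
      using mode_matrix_entry(1)[OF n' i] .
    have "B i = col ?B (m - 1) $ ?r i"
      using mode_matrix_entry(3)[OF n' i, of B] r m' unfolding c im by simp
    also have "\<dots> = (\<Sum>k<I n. ?A $$ (?r i, k) * w $ k)"
      using r w(1) unfolding w(2)[symmetric]
      by (auto simp: dims scalar_prod_def atLeast0LessThan intro!: sum.cong)
    \<comment> \<open>Passes from columns numbered from 0 to tensor indices starting at 1.\<close>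
    also have "\<dots> = (\<Sum>k\<in>{1..I n}. ?A $$ (?r i, k - 1) * w $ (k - 1))"
      by (rule sum.reindex_bij_witness[of _ "\<lambda>k. k - 1" Suc]) auto
    also have "\<dots> = (\<Sum>k\<in>{1..I n}. A (i(n := k)) * w $ (k - 1))"
      by (intro sum.cong) (simp_all only: A)
    finally show "B i = (\<Sum>k\<in>{1..I n}. A (i(n := k)) * w $ (k - 1))" .
  qed
qed

lemma mode_matrix_column_space_mono:
  fixes A B :: "(nat \<Rightarrow> nat) \<Rightarrow> 'a :: field"
  assumes S: "S \<subseteq> {1..N}" and n: "n \<in> S"
    and sub: "column_space (mode_matrix N I {n} B) \<subseteq> column_space (mode_matrix N I {n} A)"
  shows "column_space (mode_matrix N I S B) \<subseteq> column_space (mode_matrix N I S A)"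
proof (rule column_space_subsetI)
  let ?A = "mode_matrix N I S A" and ?B = "mode_matrix N I S B"
  let ?r = "linear_index I (sorted_list_of_set ({1..N} - S))"
    and ?c = "linear_index I (sorted_list_of_set S)"
  show dims: "dim_row ?A = dim_row ?B"
    by (simp add: mode_matrix_def)
  have fin: "finite S"
    using S finite_subset by blast
  have nN: "n \<in> {1..N}"
    using S n by blast
  fix j assume j: "j < dim_col ?B"
  then have j': "j < (\<Prod>p\<in>S. I p)"
    by (simp add: mode_matrix_def)
  \<comment> \<open>\<open>p\<close> decodes column \<open>j\<close> into the modes in
    \<open>S\<close>. It is fixed before any row, so the slice \<open>p n\<close>, the coefficients
    \<open>x\<close> and the columns \<open>?c (p(n := k))\<close> are common to all rows.\<close>
  obtain p where p: "\<forall>q\<in>S. p q \<in> {1..I q}" "?c p = j"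
    using linear_index_surj[of "sorted_list_of_set S" j I] j' fin by auto
  obtain x where x: "\<And>i. i \<in> multi_indices N I \<Longrightarrow> i n = p n \<Longrightarrow>
      B i = (\<Sum>k\<in>{1..I n}. A (i(n := k)) * x k)"
    using slice_combination[OF nN _ sub] p(1) n by blast
  show "col ?B j \<in> column_space ?A"
  proof (rule column_combination_in_column_space)
    show "?c (p(n := k)) < dim_col ?A" if "k \<in> {1..I n}" for k
      using linear_index_less[of "sorted_list_of_set S" "p(n := k)" I] p(1) that fin
      by (simp add: mode_matrix_def)
    fix r assume r: "r < dim_row ?A"
    then have "r < (\<Prod>p\<in>{1..N} - S. I p)"
      by (simp add: mode_matrix_def)
    \<comment> \<open>\<open>i\<close> is the full multi-index of the entry \<open>(r, j)\<close>;
      by injectivity of the column numbering it agrees with \<open>p\<close> on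
      \<open>S\<close>.\<close>
    from ex1_implies_ex[OF ex1_multi_index[OF S this j']]
    obtain i where i: "i \<in> multi_indices N I" "?r i = r" "?c i = j"
      by blast
    have "\<forall>q\<in>S. i q \<in> {1..I q}"
      using i(1) S unfolding multi_indices_def by blast
    then have agree: "\<forall>q\<in>S. i q = p q"
      using linear_index_inj[of "sorted_list_of_set S" i I p] i(3) p fin by simp
    \<comment> \<open>As \<open>n\<close> lies in \<open>S\<close>, the update keeps row
      \<open>r\<close>; the column sees only modes in \<open>S\<close>, where
      \<open>i(n := k)\<close> and \<open>p(n := k)\<close> coincide.\<close>
    have "?A $$ (r, ?c (p(n := k))) = A (i(n := k))" if "k \<in> {1..I n}" for k
    proof -
      have "?r (i(n := k)) = ?r i"
        using n by (intro linear_index_cong) auto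
      moreover have "?c (i(n := k)) = ?c (p(n := k))"
        using agree fin by (intro linear_index_cong) auto
      ultimately show ?thesis
        using mode_matrix_entry(3)[OF S multi_indices_fun_upd[OF i(1) nN that], of A] i(2) by simp
    qed
    moreover have "col ?B j $ r = B i"
      using mode_matrix_entry(3)[OF S i(1), of B] i r j by (simp add: dims)
    ultimately show "col ?B j $ r = (\<Sum>k\<in>{1..I n}. ?A $$ (r, ?c (p(n := k))) * x k)"
      using x[OF i(1)] agree n by simp
  qed (simp_all add: dims)
qed

theorem corollary4p5:
  fixes N :: nat and I :: "nat \<Rightarrow> nat"
  assumes "N \<ge> 4" and "\<And>n. n \<in> {1..N} \<Longrightarrow> I n \<ge> 1"
  shows
    "(\<forall>A \<in> tensors N I. \<forall>B \<in> tensors N I.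
        (\<forall>n\<in>{1..N}. column_space (mode_matrix N I {n} (B :: (nat \<Rightarrow> nat) \<Rightarrow> real))
                     \<subseteq> column_space (mode_matrix N I {n} A)) \<longrightarrow>
        (\<forall>S. S \<noteq> {} \<and> S \<subset> {1..N} \<longrightarrow>
           column_space (mode_matrix N I S B) \<subseteq> column_space (mode_matrix N I S A)))
     \<and>
     (\<forall>A \<in> tensors N I. \<forall>B \<in> tensors N I.
        (\<forall>n\<in>{1..N}. column_space (mode_matrix N I {n} (B :: (nat \<Rightarrow> nat) \<Rightarrow> complex))
                     \<subseteq> column_space (mode_matrix N I {n} A)) \<longrightarrow>
        (\<forall>S. S \<noteq> {} \<and> S \<subset> {1..N} \<longrightarrow>
           column_space (mode_matrix N I S B) \<subseteq> column_space (mode_matrix N I S A)))"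
proof (intro conjI ballI impI allI; elim conjE)
  fix A B :: "(nat \<Rightarrow> nat) \<Rightarrow> real" and S
  assume "\<forall>n\<in>{1..N}. column_space (mode_matrix N I {n} B) \<subseteq> column_space (mode_matrix N I {n} A)"
    and "S \<noteq> {}" "S \<subset> {1..N}"
  \<comment> \<open>Any element of the nonempty set \<open>S\<close> can serve as the mode
    \<open>n\<close>.\<close>
  then show "column_space (mode_matrix N I S B) \<subseteq> column_space (mode_matrix N I S A)"
    by (meson all_not_in_conv mode_matrix_column_space_mono psubset_imp_subset subsetD)
next
  fix A B :: "(nat \<Rightarrow> nat) \<Rightarrow> complex" and S
  assume "\<forall>n\<in>{1..N}. column_space (mode_matrix N I {n} B) \<subseteq> column_space (mode_matrix N I {n} A)"
    and "S \<noteq> {}" "S \<subset> {1..N}"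
  then show "column_space (mode_matrix N I S B) \<subseteq> column_space (mode_matrix N I S A)"
    by (meson all_not_in_conv mode_matrix_column_space_mono psubset_imp_subset subsetD)
qed

end
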